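(* For every finite dimensional Lie algebra $L$ over a field, $Z^*(L)=Z^{\wedge}(L)$.
   Context: All Lie algebras are finite dimensional over a fixed field. For a Lie algebra $E$, $Z(E)$ denotes its center. A central extension $(E,\phi)$ of $L$ is a Lie algebra $E$ with a surjective homomorphism $\phi:E\to L$ such that $\ker\phi\subseteq Z(E)$. Define $Z^*(L)=\bigcap\{\phi(Z(E)) : (E,\phi)\text{ is a central extension of }L\}$. The (non-abelian) exterior square $L\wedge L$ is the Lie algebra generated by symbols $l\wedge l'$ ($l,l'\in L$), bilinear in $l$ and $l'$, subject to $l\wedge l=0$, $[l,l']\wedge m=l\wedge[l',m]-l'\wedge[l,m]$, $l\wedge[m,m']=[m',l]\wedge m-[m,l]\wedge m'$, and $[l\wedge m,\,l'\wedge m']=[l,m]\wedge[l',m']$ for all $l,l',m,m'\in L$. Define $Z^{\wedge}(L)=\{l\in L : l\wedge x=0 \text{ in } L\wedge L\text{ for all }x\in L\}$. *)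

theory Defs
  imports "HOL-Algebra.Module"
begin

section \<open>Lie algebras over a field\<close>

text \<open>
  A Lie algebra is a vector space (a \<open>module\<close> over a field) whose record component \<open>mult\<close> is the
  Lie bracket: \<open>x \<otimes>\<^bsub>L\<^esub> y\<close> is $[x,y]$.  The component \<open>one\<close>, which the record type inherits from
  the library, plays no role anywhere.
\<close>

locale lie_algebra = K?: field K + module K L for K (structure) and L (structure) +
  assumes bracket_closed [simp, intro]:
      "\<lbrakk>x \<in> carrier L; y \<in> carrier L\<rbrakk> \<Longrightarrow> x \<otimes>\<^bsub>L\<^esub> y \<in> carrier L"
    and bracket_add_left:
      "\<lbrakk>x \<in> carrier L; y \<in> carrier L; z \<in> carrier L\<rbrakk> \<Longrightarrow>
        (x \<oplus>\<^bsub>L\<^esub> y) \<otimes>\<^bsub>L\<^esub> z = (x \<otimes>\<^bsub>L\<^esub> z) \<oplus>\<^bsub>L\<^esub> (y \<otimes>\<^bsub>L\<^esub> z)"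
    and bracket_add_right:
      "\<lbrakk>x \<in> carrier L; y \<in> carrier L; z \<in> carrier L\<rbrakk> \<Longrightarrow>
        x \<otimes>\<^bsub>L\<^esub> (y \<oplus>\<^bsub>L\<^esub> z) = (x \<otimes>\<^bsub>L\<^esub> y) \<oplus>\<^bsub>L\<^esub> (x \<otimes>\<^bsub>L\<^esub> z)"
    and bracket_smult_left:
      "\<lbrakk>a \<in> carrier K; x \<in> carrier L; y \<in> carrier L\<rbrakk> \<Longrightarrow>
        (a \<odot>\<^bsub>L\<^esub> x) \<otimes>\<^bsub>L\<^esub> y = a \<odot>\<^bsub>L\<^esub> (x \<otimes>\<^bsub>L\<^esub> y)"
    and bracket_smult_right:
      "\<lbrakk>a \<in> carrier K; x \<in> carrier L; y \<in> carrier L\<rbrakk> \<Longrightarrow>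
        x \<otimes>\<^bsub>L\<^esub> (a \<odot>\<^bsub>L\<^esub> y) = a \<odot>\<^bsub>L\<^esub> (x \<otimes>\<^bsub>L\<^esub> y)"
    and bracket_self:
      "x \<in> carrier L \<Longrightarrow> x \<otimes>\<^bsub>L\<^esub> x = \<zero>\<^bsub>L\<^esub>"
    and jacobi:
      "\<lbrakk>x \<in> carrier L; y \<in> carrier L; z \<in> carrier L\<rbrakk> \<Longrightarrow>
        x \<otimes>\<^bsub>L\<^esub> (y \<otimes>\<^bsub>L\<^esub> z) \<oplus>\<^bsub>L\<^esub> y \<otimes>\<^bsub>L\<^esub> (z \<otimes>\<^bsub>L\<^esub> x) \<oplus>\<^bsub>L\<^esub> z \<otimes>\<^bsub>L\<^esub> (x \<otimes>\<^bsub>L\<^esub> y) = \<zero>\<^bsub>L\<^esub>"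

definition finite_dim :: "('k, 'c) ring_scheme \<Rightarrow> ('k, 'v, 'm) module_scheme \<Rightarrow> bool" where
  "finite_dim K L \<longleftrightarrow>
    (\<exists>B. finite B \<and> B \<subseteq> carrier L \<and>
      (\<forall>v \<in> carrier L. \<exists>a \<in> B \<rightarrow> carrier K. v = (\<Oplus>\<^bsub>L\<^esub>b \<in> B. a b \<odot>\<^bsub>L\<^esub> b)))"

locale fin_dim_lie_algebra = lie_algebra +
  assumes fin_dim: "finite_dim K L"

definition lie_hom ::
  "('k, 'c) ring_scheme \<Rightarrow> ('k, 'v, 'm) module_scheme \<Rightarrow> ('k, 'w, 'n) module_scheme \<Rightarrow> ('v \<Rightarrow> 'w) set"
where
  "lie_hom K E L = {\<phi> \<in> carrier E \<rightarrow> carrier L.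
    (\<forall>x \<in> carrier E. \<forall>y \<in> carrier E. \<phi> (x \<oplus>\<^bsub>E\<^esub> y) = \<phi> x \<oplus>\<^bsub>L\<^esub> \<phi> y) \<and>
    (\<forall>a \<in> carrier K. \<forall>x \<in> carrier E. \<phi> (a \<odot>\<^bsub>E\<^esub> x) = a \<odot>\<^bsub>L\<^esub> \<phi> x) \<and>
    (\<forall>x \<in> carrier E. \<forall>y \<in> carrier E. \<phi> (x \<otimes>\<^bsub>E\<^esub> y) = \<phi> x \<otimes>\<^bsub>L\<^esub> \<phi> y)}"

definition lie_center :: "('k, 'v, 'm) module_scheme \<Rightarrow> 'v set" where
  "lie_center L = {z \<in> carrier L. \<forall>x \<in> carrier L. z \<otimes>\<^bsub>L\<^esub> x = \<zero>\<^bsub>L\<^esub>}"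


section \<open>Central extensions\<close>

definition central_extension ::
  "('k, 'c) ring_scheme \<Rightarrow> ('k, 'v, 'm) module_scheme \<Rightarrow> ('k, 'w, 'n) module_scheme \<Rightarrow> ('w \<Rightarrow> 'v) \<Rightarrow> bool"
where
  "central_extension K L E \<phi> \<longleftrightarrow>
    fin_dim_lie_algebra K E \<and> \<phi> \<in> lie_hom K E L \<and> \<phi> ` carrier E = carrier L \<and>
    {e \<in> carrier E. \<phi> e = \<zero>\<^bsub>L\<^esub>} \<subseteq> lie_center E"

text \<open>
  A definition cannot quantify over types, so the extensions \<open>E\<close> below have a carrier in the fixed
  type \<open>nat \<Rightarrow> 'k\<close>, with arbitrary operations.  This is no restriction, since every finite
  dimensional Lie algebra over a field with elements in \<open>'k\<close> has an isomorphic copy of this kind;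
  see \<open>Z_star_subset\<close> below, where \<open>E\<close> may live on any type.
\<close>

definition Z_star :: "('k, 'c) ring_scheme \<Rightarrow> ('k, 'v, 'm) module_scheme \<Rightarrow> 'v set" where
  "Z_star K L = \<Inter>{\<phi> ` lie_center E | (E :: ('k, nat \<Rightarrow> 'k) module) \<phi>. central_extension K L E \<phi>}"


section \<open>Lie algebras given by generators and relations\<close>

text \<open>
  The Lie algebra over \<open>K\<close> generated by \<open>X\<close> subject to relations \<open>R\<close> (pairs of terms to be
  identified) consists of the formal terms over \<open>X\<close> modulo the least congruence that satisfies the
  axioms of a Lie algebra and contains \<open>R\<close>.
\<close>

datatype ('k, 'x) lie_term =
    TZero
  | TGen 'x
  | TAdd "('k, 'x) lie_term" "('k, 'x) lie_term"
  | TSmult 'k "('k, 'x) lie_term"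
  | TBr "('k, 'x) lie_term" "('k, 'x) lie_term"

inductive_set lie_terms :: "('k, 'c) ring_scheme \<Rightarrow> 'x set \<Rightarrow> ('k, 'x) lie_term set"
  for K :: "('k, 'c) ring_scheme" and X :: "'x set"
where
  zero: "TZero \<in> lie_terms K X"
| gen: "x \<in> X \<Longrightarrow> TGen x \<in> lie_terms K X"
| add: "\<lbrakk>s \<in> lie_terms K X; t \<in> lie_terms K X\<rbrakk> \<Longrightarrow> TAdd s t \<in> lie_terms K X"
| smult: "\<lbrakk>a \<in> carrier K; t \<in> lie_terms K X\<rbrakk> \<Longrightarrow> TSmult a t \<in> lie_terms K X"
| br: "\<lbrakk>s \<in> lie_terms K X; t \<in> lie_terms K X\<rbrakk> \<Longrightarrow> TBr s t \<in> lie_terms K X"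

inductive lie_cong ::
  "('k, 'c) ring_scheme \<Rightarrow> 'x set \<Rightarrow> (('k, 'x) lie_term \<times> ('k, 'x) lie_term) set \<Rightarrow>
    ('k, 'x) lie_term \<Rightarrow> ('k, 'x) lie_term \<Rightarrow> bool"
  for K :: "('k, 'c) ring_scheme" (structure) and X :: "'x set"
    and R :: "(('k, 'x) lie_term \<times> ('k, 'x) lie_term) set"
where
  rel: "\<lbrakk>(s, t) \<in> R; s \<in> lie_terms K X; t \<in> lie_terms K X\<rbrakk> \<Longrightarrow> lie_cong K X R s t"
| refl: "s \<in> lie_terms K X \<Longrightarrow> lie_cong K X R s s"
| sym: "lie_cong K X R s t \<Longrightarrow> lie_cong K X R t s"
| trans: "\<lbrakk>lie_cong K X R s t; lie_cong K X R t u\<rbrakk> \<Longrightarrow> lie_cong K X R s u"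
| cong_add: "\<lbrakk>lie_cong K X R s s'; lie_cong K X R t t'\<rbrakk> \<Longrightarrow> lie_cong K X R (TAdd s t) (TAdd s' t')"
| cong_smult: "\<lbrakk>a \<in> carrier K; lie_cong K X R t t'\<rbrakk> \<Longrightarrow> lie_cong K X R (TSmult a t) (TSmult a t')"
| cong_br: "\<lbrakk>lie_cong K X R s s'; lie_cong K X R t t'\<rbrakk> \<Longrightarrow> lie_cong K X R (TBr s t) (TBr s' t')"
| add_assoc: "\<lbrakk>s \<in> lie_terms K X; t \<in> lie_terms K X; u \<in> lie_terms K X\<rbrakk> \<Longrightarrow>
    lie_cong K X R (TAdd (TAdd s t) u) (TAdd s (TAdd t u))"
| add_comm: "\<lbrakk>s \<in> lie_terms K X; t \<in> lie_terms K X\<rbrakk> \<Longrightarrow> lie_cong K X R (TAdd s t) (TAdd t s)"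
| add_zero: "t \<in> lie_terms K X \<Longrightarrow> lie_cong K X R (TAdd TZero t) t"
| add_neg: "t \<in> lie_terms K X \<Longrightarrow> lie_cong K X R (TAdd (TSmult (\<ominus> \<one>) t) t) TZero"
| smult_add: "\<lbrakk>a \<in> carrier K; s \<in> lie_terms K X; t \<in> lie_terms K X\<rbrakk> \<Longrightarrow>
    lie_cong K X R (TSmult a (TAdd s t)) (TAdd (TSmult a s) (TSmult a t))"
| add_smult: "\<lbrakk>a \<in> carrier K; b \<in> carrier K; t \<in> lie_terms K X\<rbrakk> \<Longrightarrow>
    lie_cong K X R (TSmult (a \<oplus> b) t) (TAdd (TSmult a t) (TSmult b t))"
| mult_smult: "\<lbrakk>a \<in> carrier K; b \<in> carrier K; t \<in> lie_terms K X\<rbrakk> \<Longrightarrow>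
    lie_cong K X R (TSmult (a \<otimes> b) t) (TSmult a (TSmult b t))"
| one_smult: "t \<in> lie_terms K X \<Longrightarrow> lie_cong K X R (TSmult \<one> t) t"
| br_add_left: "\<lbrakk>s \<in> lie_terms K X; t \<in> lie_terms K X; u \<in> lie_terms K X\<rbrakk> \<Longrightarrow>
    lie_cong K X R (TBr (TAdd s t) u) (TAdd (TBr s u) (TBr t u))"
| br_add_right: "\<lbrakk>s \<in> lie_terms K X; t \<in> lie_terms K X; u \<in> lie_terms K X\<rbrakk> \<Longrightarrow>
    lie_cong K X R (TBr s (TAdd t u)) (TAdd (TBr s t) (TBr s u))"
| br_smult_left: "\<lbrakk>a \<in> carrier K; s \<in> lie_terms K X; t \<in> lie_terms K X\<rbrakk> \<Longrightarrow>
    lie_cong K X R (TBr (TSmult a s) t) (TSmult a (TBr s t))"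
| br_smult_right: "\<lbrakk>a \<in> carrier K; s \<in> lie_terms K X; t \<in> lie_terms K X\<rbrakk> \<Longrightarrow>
    lie_cong K X R (TBr s (TSmult a t)) (TSmult a (TBr s t))"
| br_self: "t \<in> lie_terms K X \<Longrightarrow> lie_cong K X R (TBr t t) TZero"
| br_jacobi: "\<lbrakk>s \<in> lie_terms K X; t \<in> lie_terms K X; u \<in> lie_terms K X\<rbrakk> \<Longrightarrow>
    lie_cong K X R (TAdd (TAdd (TBr s (TBr t u)) (TBr t (TBr u s))) (TBr u (TBr s t))) TZero"

definition lie_class ::
  "('k, 'c) ring_scheme \<Rightarrow> 'x set \<Rightarrow> (('k, 'x) lie_term \<times> ('k, 'x) lie_term) set \<Rightarrow>
    ('k, 'x) lie_term \<Rightarrow> ('k, 'x) lie_term set"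
where
  "lie_class K X R t = {s. lie_cong K X R t s}"

definition lie_presentation ::
  "('k, 'c) ring_scheme \<Rightarrow> 'x set \<Rightarrow> (('k, 'x) lie_term \<times> ('k, 'x) lie_term) set \<Rightarrow>
    ('k, ('k, 'x) lie_term set) module"
where
  "lie_presentation K X R =
    \<lparr>carrier = lie_class K X R ` lie_terms K X,
     mult = (\<lambda>A B. \<Union>s \<in> A. \<Union>t \<in> B. lie_class K X R (TBr s t)),
     one = undefined,
     zero = lie_class K X R TZero,
     add = (\<lambda>A B. \<Union>s \<in> A. \<Union>t \<in> B. lie_class K X R (TAdd s t)),
     smult = (\<lambda>a A. \<Union>t \<in> A. lie_class K X R (TSmult a t))\<rparr>"


section \<open>The non-abelian exterior square\<close>

abbreviation TWedge :: "'v \<Rightarrow> 'v \<Rightarrow> ('k, 'v \<times> 'v) lie_term" where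
  "TWedge x y \<equiv> TGen (x, y)"

abbreviation TDiff ::
  "('k, 'c) ring_scheme \<Rightarrow> ('k, 'x) lie_term \<Rightarrow> ('k, 'x) lie_term \<Rightarrow> ('k, 'x) lie_term"
where
  "TDiff K s t \<equiv> TAdd s (TSmult (\<ominus>\<^bsub>K\<^esub> \<one>\<^bsub>K\<^esub>) t)"

inductive_set wedge_relations ::
  "('k, 'c) ring_scheme \<Rightarrow> ('k, 'v, 'm) module_scheme \<Rightarrow>
    (('k, 'v \<times> 'v) lie_term \<times> ('k, 'v \<times> 'v) lie_term) set"
  for K :: "('k, 'c) ring_scheme" and L :: "('k, 'v, 'm) module_scheme" (structure)
where
  wedge_add_left: "\<lbrakk>l \<in> carrier L; l' \<in> carrier L; m \<in> carrier L\<rbrakk> \<Longrightarrow>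
    (TWedge (l \<oplus> l') m, TAdd (TWedge l m) (TWedge l' m)) \<in> wedge_relations K L"
| wedge_add_right: "\<lbrakk>l \<in> carrier L; m \<in> carrier L; m' \<in> carrier L\<rbrakk> \<Longrightarrow>
    (TWedge l (m \<oplus> m'), TAdd (TWedge l m) (TWedge l m')) \<in> wedge_relations K L"
| wedge_smult_left: "\<lbrakk>a \<in> carrier K; l \<in> carrier L; m \<in> carrier L\<rbrakk> \<Longrightarrow>
    (TWedge (a \<odot> l) m, TSmult a (TWedge l m)) \<in> wedge_relations K L"
| wedge_smult_right: "\<lbrakk>a \<in> carrier K; l \<in> carrier L; m \<in> carrier L\<rbrakk> \<Longrightarrow>
    (TWedge l (a \<odot> m), TSmult a (TWedge l m)) \<in> wedge_relations K L"
| wedge_self: "l \<in> carrier L \<Longrightarrow> (TWedge l l, TZero) \<in> wedge_relations K L"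
| wedge_bracket_left: "\<lbrakk>l \<in> carrier L; l' \<in> carrier L; m \<in> carrier L\<rbrakk> \<Longrightarrow>
    (TWedge (l \<otimes> l') m, TDiff K (TWedge l (l' \<otimes> m)) (TWedge l' (l \<otimes> m))) \<in> wedge_relations K L"
| wedge_bracket_right: "\<lbrakk>l \<in> carrier L; m \<in> carrier L; m' \<in> carrier L\<rbrakk> \<Longrightarrow>
    (TWedge l (m \<otimes> m'), TDiff K (TWedge (m' \<otimes> l) m) (TWedge (m \<otimes> l) m')) \<in> wedge_relations K L"
| bracket_wedge: "\<lbrakk>l \<in> carrier L; m \<in> carrier L; l' \<in> carrier L; m' \<in> carrier L\<rbrakk> \<Longrightarrow>
    (TBr (TWedge l m) (TWedge l' m'), TWedge (l \<otimes> m) (l' \<otimes> m')) \<in> wedge_relations K L"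

definition exterior_square ::
  "('k, 'c) ring_scheme \<Rightarrow> ('k, 'v, 'm) module_scheme \<Rightarrow> ('k, ('k, 'v \<times> 'v) lie_term set) module"
where
  "exterior_square K L = lie_presentation K (carrier L \<times> carrier L) (wedge_relations K L)"

definition wedge ::
  "('k, 'c) ring_scheme \<Rightarrow> ('k, 'v, 'm) module_scheme \<Rightarrow> 'v \<Rightarrow> 'v \<Rightarrow> ('k, 'v \<times> 'v) lie_term set"
where
  "wedge K L x y = lie_class K (carrier L \<times> carrier L) (wedge_relations K L) (TWedge x y)"

definition Z_wedge :: "('k, 'c) ring_scheme \<Rightarrow> ('k, 'v, 'm) module_scheme \<Rightarrow> 'v set" where
  "Z_wedge K L =
    {l \<in> carrier L. \<forall>x \<in> carrier L. wedge K L l x = \<zero>\<^bsub>exterior_square K L\<^esub>}"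


section \<open>Adequacy of the definitions\<close>

subsection \<open>Presentations\<close>

lemma lie_cong_terms:
  assumes "field K" "lie_cong K X R s t"
  shows "s \<in> lie_terms K X \<and> t \<in> lie_terms K X"
proof -
  interpret field K by fact
  from assms(2) show ?thesis
    by (induction) (auto intro: lie_terms.intros)
qed

lemma lie_class_eqI: "lie_cong K X R s t \<Longrightarrow> lie_class K X R s = lie_class K X R t"
  unfolding lie_class_def by (blast intro: lie_cong.sym lie_cong.trans)

lemma lie_class_eq_iff:
  assumes "t \<in> lie_terms K X"
  shows "lie_class K X R s = lie_class K X R t \<longleftrightarrow> lie_cong K X R s t"
proof
  assume "lie_class K X R s = lie_class K X R t"
  moreover have "t \<in> lie_class K X R t"
    by (simp add: lie_class_def lie_cong.refl[OF assms])
  ultimately show "lie_cong K X R s t"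
    by (metis lie_class_def mem_Collect_eq)
qed (rule lie_class_eqI)

lemma lie_presentation_simps:
  fixes K :: "('k, 'c) ring_scheme" and R :: "(('k, 'x) lie_term \<times> ('k, 'x) lie_term) set"
  assumes "s \<in> lie_terms K X" "t \<in> lie_terms K X"
  shows "lie_class K X R s \<oplus>\<^bsub>lie_presentation K X R\<^esub> lie_class K X R t = lie_class K X R (TAdd s t)"
    and "lie_class K X R s \<otimes>\<^bsub>lie_presentation K X R\<^esub> lie_class K X R t = lie_class K X R (TBr s t)"
    and "a \<in> carrier K \<Longrightarrow>
      a \<odot>\<^bsub>lie_presentation K X R\<^esub> lie_class K X R t = lie_class K X R (TSmult a t)"
proof -
  have self: "\<And>u. u \<in> lie_terms K X \<Longrightarrow> u \<in> lie_class K X R u"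
    by (simp add: lie_class_def lie_cong.refl)
  have UN_eq: "(\<Union>u \<in> lie_class K X R v. F u) = C"
    if "v \<in> lie_terms K X" "\<And>u. lie_cong K X R v u \<Longrightarrow> F u = C"
    for v C and F :: "('k, 'x) lie_term \<Rightarrow> ('k, 'x) lie_term set"
    using self[OF that(1)] that(2) unfolding lie_class_def by blast
  show "lie_class K X R s \<oplus>\<^bsub>lie_presentation K X R\<^esub> lie_class K X R t = lie_class K X R (TAdd s t)"
    by (simp add: lie_presentation_def)
      (intro UN_eq assms lie_class_eqI[symmetric] lie_cong.cong_add)
  show "lie_class K X R s \<otimes>\<^bsub>lie_presentation K X R\<^esub> lie_class K X R t = lie_class K X R (TBr s t)"
    by (simp add: lie_presentation_def)
      (intro UN_eq assms lie_class_eqI[symmetric] lie_cong.cong_br)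
  assume "a \<in> carrier K"
  then show "a \<odot>\<^bsub>lie_presentation K X R\<^esub> lie_class K X R t = lie_class K X R (TSmult a t)"
    by (simp add: lie_presentation_def)
      (intro UN_eq assms lie_class_eqI[symmetric] lie_cong.cong_smult)
qed

lemma lie_presentation_zero: "\<zero>\<^bsub>lie_presentation K X R\<^esub> = lie_class K X R TZero"
  by (simp add: lie_presentation_def)

lemma lie_presentation_carrier: "carrier (lie_presentation K X R) = lie_class K X R ` lie_terms K X"
  by (simp add: lie_presentation_def)

theorem lie_algebra_lie_presentation:
  assumes K: "field K"
  shows "lie_algebra K (lie_presentation K X R)"
proof -
  interpret field K by fact
  have one: "\<one>\<^bsub>K\<^esub> \<in> carrier K" "\<ominus>\<^bsub>K\<^esub> \<one>\<^bsub>K\<^esub> \<in> carrier K" by auto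
  note simps = lie_presentation_carrier lie_presentation_zero lie_presentation_simps
    lie_terms.intros one
  note eqs = lie_cong.add_zero lie_cong.add_neg
    lie_cong.smult_add lie_cong.add_smult lie_cong.mult_smult lie_cong.one_smult
    lie_cong.br_add_left lie_cong.br_add_right lie_cong.br_smult_left lie_cong.br_smult_right
    lie_cong.br_self lie_cong.br_jacobi
  note eqs = eqs[THEN lie_class_eqI]
  have grp: "abelian_group (lie_presentation K X R)"
  proof (rule abelian_groupI)
    fix x y
    assume "x \<in> carrier (lie_presentation K X R)" "y \<in> carrier (lie_presentation K X R)"
    then show "x \<oplus>\<^bsub>lie_presentation K X R\<^esub> y = y \<oplus>\<^bsub>lie_presentation K X R\<^esub> x"
      using lie_cong.add_comm[THEN lie_class_eqI] by (fastforce simp: simps)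
  next
    fix x assume "x \<in> carrier (lie_presentation K X R)"
    then obtain t where t: "t \<in> lie_terms K X" "x = lie_class K X R t"
      by (auto simp: simps)
    then show "\<exists>y \<in> carrier (lie_presentation K X R).
        y \<oplus>\<^bsub>lie_presentation K X R\<^esub> x = \<zero>\<^bsub>lie_presentation K X R\<^esub>"
      by (intro bexI[of _ "lie_class K X R (TSmult (\<ominus>\<^bsub>K\<^esub> \<one>\<^bsub>K\<^esub>) t)"]) (auto simp: simps eqs)
  qed (auto simp: simps eqs lie_cong.add_assoc[THEN lie_class_eqI])
  have module: "module K (lie_presentation K X R)"
    by (rule moduleI[OF is_cring grp]) (auto simp: simps eqs)
  show ?thesis
  proof (intro lie_algebra.intro lie_algebra_axioms.intro)
    show "field K" by fact
    show "module K (lie_presentation K X R)" by fact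
  qed (auto simp: simps eqs)
qed

primrec lie_eval :: "('k, 'w, 'n) module_scheme \<Rightarrow> ('x \<Rightarrow> 'w) \<Rightarrow> ('k, 'x) lie_term \<Rightarrow> 'w" where
  "lie_eval E f TZero = \<zero>\<^bsub>E\<^esub>"
| "lie_eval E f (TGen x) = f x"
| "lie_eval E f (TAdd s t) = lie_eval E f s \<oplus>\<^bsub>E\<^esub> lie_eval E f t"
| "lie_eval E f (TSmult a t) = a \<odot>\<^bsub>E\<^esub> lie_eval E f t"
| "lie_eval E f (TBr s t) = lie_eval E f s \<otimes>\<^bsub>E\<^esub> lie_eval E f t"

theorem lie_presentation_universal:
  assumes E: "lie_algebra K E" and f: "f \<in> X \<rightarrow> carrier E"
    and R: "\<And>s t. \<lbrakk>(s, t) \<in> R; s \<in> lie_terms K X; t \<in> lie_terms K X\<rbrakk> \<Longrightarrow> lie_eval E f s = lie_eval E f t"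
  shows "\<exists>\<psi> \<in> lie_hom K (lie_presentation K X R) E. \<forall>x \<in> X. \<psi> (lie_class K X R (TGen x)) = f x"
proof -
  interpret lie_algebra K E by fact
  have closed: "lie_eval E f t \<in> carrier E" if "t \<in> lie_terms K X" for t
    using that by induction (use f in auto)
  have cong: "lie_eval E f s = lie_eval E f t" if "lie_cong K X R s t" for s t
    using that
  proof induction
    case (rel s t)
    then show ?case by (rule R)
  next
    case (add_neg t)
    then show ?case by (simp add: closed smult_l_minus M.l_neg)
  next
    case (add_comm s t)
    then show ?case by (simp add: closed M.a_comm)
  qed (auto simp: closed bracket_add_left bracket_add_right bracket_smult_left bracket_smult_right
      bracket_self jacobi M.a_assoc[symmetric] smult_l_distr smult_r_distr smult_assoc1)
  define \<psi> where "\<psi> A = lie_eval E f (SOME t. t \<in> A)" for A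
  have \<psi>: "\<psi> (lie_class K X R t) = lie_eval E f t" if "t \<in> lie_terms K X" for t
  proof -
    have "(SOME s. s \<in> lie_class K X R t) \<in> lie_class K X R t"
      by (rule someI[of _ t]) (simp add: lie_class_def lie_cong.refl that)
    then show ?thesis
      using cong by (simp add: \<psi>_def lie_class_def)
  qed
  show ?thesis
  proof (intro bexI[of _ \<psi>] ballI)
    show "\<psi> \<in> lie_hom K (lie_presentation K X R) E"
      by (auto simp: lie_hom_def lie_presentation_carrier lie_presentation_simps \<psi> closed
          lie_terms.intros)
  qed (simp add: \<psi> lie_terms.gen)
qed


subsection \<open>Independence of the carrier type of central extensions\<close>

lemma fin_dim_lie_algebra_inj:
  fixes K :: "('k, 'c) ring_scheme" and E :: "('k, 'w, 'n) module_scheme"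
  assumes "fin_dim_lie_algebra K E"
  shows "\<exists>f :: 'w \<Rightarrow> nat \<Rightarrow> 'k. inj_on f (carrier E)"
proof -
  interpret fin_dim_lie_algebra K E by fact
  obtain B where B: "finite B" "B \<subseteq> carrier E"
    and "\<forall>v \<in> carrier E. \<exists>a \<in> B \<rightarrow> carrier K. v = (\<Oplus>\<^bsub>E\<^esub>b \<in> B. a b \<odot>\<^bsub>E\<^esub> b)"
    using fin_dim unfolding finite_dim_def by blast
  then obtain c where c: "\<And>v. v \<in> carrier E \<Longrightarrow> c v \<in> B \<rightarrow> carrier K"
    "\<And>v. v \<in> carrier E \<Longrightarrow> v = (\<Oplus>\<^bsub>E\<^esub>b \<in> B. c v b \<odot>\<^bsub>E\<^esub> b)"
    by metis
  obtain g :: "nat \<Rightarrow> 'w" where g: "B \<subseteq> range g"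
    using B(1) by (metis finite_imp_nat_seg_image_inj_on image_mono subset_UNIV)
  have "inj_on (\<lambda>v i. c v (g i)) (carrier E)"
  proof (rule inj_onI)
    fix v w
    assume vw: "v \<in> carrier E" "w \<in> carrier E" and eq: "(\<lambda>i. c v (g i)) = (\<lambda>i. c w (g i))"
    have "c v b = c w b" if "b \<in> B" for b
      using that g fun_cong[OF eq] by blast
    then have "(\<Oplus>\<^bsub>E\<^esub>b \<in> B. c v b \<odot>\<^bsub>E\<^esub> b) = (\<Oplus>\<^bsub>E\<^esub>b \<in> B. c w b \<odot>\<^bsub>E\<^esub> b)"
      using B c(1) vw by (intro M.finsum_cong') (auto simp: Pi_iff subset_eq)
    then show "v = w"
      using c(2) vw by metis
  qed
  then show ?thesis by blast
qed

definition transport :: "('w \<Rightarrow> 'u) \<Rightarrow> ('k, 'w, 'n) module_scheme \<Rightarrow> ('k, 'u) module" where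
  "transport f E = (let g = inv_into (carrier E) f in
     \<lparr>carrier = f ` carrier E,
      mult = (\<lambda>x y. f (g x \<otimes>\<^bsub>E\<^esub> g y)),
      one = undefined,
      zero = f \<zero>\<^bsub>E\<^esub>,
      add = (\<lambda>x y. f (g x \<oplus>\<^bsub>E\<^esub> g y)),
      smult = (\<lambda>a x. f (a \<odot>\<^bsub>E\<^esub> g x))\<rparr>)"

lemma central_extension_transport:
  assumes ext: "central_extension K L E \<phi>" and f: "inj_on f (carrier E)"
  shows "central_extension K L (transport f E) (\<phi> \<circ> inv_into (carrier E) f)"
    and "lie_center (transport f E) = f ` lie_center E"
proof -
  interpret fin_dim_lie_algebra K E
    using ext by (simp add: central_extension_def)
  let ?T = "transport f E"
  have T: "carrier ?T = f ` carrier E" "\<zero>\<^bsub>?T\<^esub> = f \<zero>\<^bsub>E\<^esub>"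
    "\<And>x y. \<lbrakk>x \<in> carrier E; y \<in> carrier E\<rbrakk> \<Longrightarrow> f x \<oplus>\<^bsub>?T\<^esub> f y = f (x \<oplus>\<^bsub>E\<^esub> y)"
    "\<And>x y. \<lbrakk>x \<in> carrier E; y \<in> carrier E\<rbrakk> \<Longrightarrow> f x \<otimes>\<^bsub>?T\<^esub> f y = f (x \<otimes>\<^bsub>E\<^esub> y)"
    "\<And>a x. x \<in> carrier E \<Longrightarrow> a \<odot>\<^bsub>?T\<^esub> f x = f (a \<odot>\<^bsub>E\<^esub> x)"
    using f by (simp_all add: transport_def Let_def)
  have g: "\<And>x. x \<in> carrier E \<Longrightarrow> inv_into (carrier E) f (f x) = x"
    using f by simp
  have inj: "\<And>x y. \<lbrakk>x \<in> carrier E; y \<in> carrier E\<rbrakk> \<Longrightarrow> f x = f y \<longleftrightarrow> x = y"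
    using f by (auto dest: inj_onD)
  show center: "lie_center ?T = f ` lie_center E"
    by (auto simp: lie_center_def T inj)
  have grp: "abelian_group ?T"
  proof (rule abelian_groupI)
    fix x assume "x \<in> carrier ?T"
    then obtain y where "y \<in> carrier E" "x = f y"
      by (auto simp: T)
    then show "\<exists>y \<in> carrier ?T. y \<oplus>\<^bsub>?T\<^esub> x = \<zero>\<^bsub>?T\<^esub>"
      by (intro bexI[of _ "f (\<ominus>\<^bsub>E\<^esub> y)"]) (simp_all add: T M.l_neg)
  qed (auto simp: T M.a_ac)
  have "module K ?T"
    by (rule moduleI[OF K.is_cring grp]) (auto simp: T smult_l_distr smult_r_distr smult_assoc1)
  then interpret T: module K ?T .
  have lie: "lie_algebra K ?T"
    by (intro_locales, unfold_locales)
      (auto simp: T bracket_add_left bracket_add_right bracket_smult_left bracket_smult_right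
        bracket_self jacobi)
  have "finite_dim K ?T"
  proof -
    obtain B where B: "finite B" "B \<subseteq> carrier E"
      and span: "\<And>v. v \<in> carrier E \<Longrightarrow>
        \<exists>a \<in> B \<rightarrow> carrier K. v = (\<Oplus>\<^bsub>E\<^esub>b \<in> B. a b \<odot>\<^bsub>E\<^esub> b)"
      using fin_dim unfolding finite_dim_def by blast
    have sum: "f (\<Oplus>\<^bsub>E\<^esub>b \<in> C. a b \<odot>\<^bsub>E\<^esub> b) = (\<Oplus>\<^bsub>?T\<^esub>b \<in> f ` C. a (inv_into (carrier E) f b) \<odot>\<^bsub>?T\<^esub> b)"
      if "finite C" "C \<subseteq> carrier E" "a \<in> C \<rightarrow> carrier K" for a C
      using that
    proof (induction C rule: finite_induct)
      case empty
      then show ?case by (simp add: T)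
    next
      case (insert x C)
      then have "f x \<notin> f ` C"
        by (auto simp: inj subset_eq)
      moreover have "(\<lambda>b. a b \<odot>\<^bsub>E\<^esub> b) \<in> C \<rightarrow> carrier E"
        using insert.prems by auto
      moreover have "(\<lambda>b. a (inv_into (carrier E) f b) \<odot>\<^bsub>?T\<^esub> b) \<in> f ` C \<rightarrow> carrier ?T"
        using insert.prems by (auto simp: T g subset_eq Pi_iff)
      moreover have "f (\<Oplus>\<^bsub>E\<^esub>b \<in> C. a b \<odot>\<^bsub>E\<^esub> b) =
          (\<Oplus>\<^bsub>?T\<^esub>b \<in> f ` C. a (inv_into (carrier E) f b) \<odot>\<^bsub>?T\<^esub> b)"
        using insert by auto
      then have "(\<Oplus>\<^bsub>?T\<^esub>b \<in> f ` C. a (inv_into (carrier E) f b) \<odot>\<^bsub>?T\<^esub> b) =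
          f (\<Oplus>\<^bsub>E\<^esub>b \<in> C. a b \<odot>\<^bsub>E\<^esub> b)"
        by simp
      ultimately show ?case
        using insert.hyps insert.prems
        by (simp add: T g M.finsum_insert T.finsum_insert M.finsum_closed)
    qed
    show ?thesis
      unfolding finite_dim_def
    proof (intro exI[of _ "f ` B"] conjI ballI)
      fix v assume "v \<in> carrier ?T"
      then obtain w where w: "w \<in> carrier E" "v = f w"
        by (auto simp: T)
      obtain a where a: "a \<in> B \<rightarrow> carrier K" "w = (\<Oplus>\<^bsub>E\<^esub>b \<in> B. a b \<odot>\<^bsub>E\<^esub> b)"
        using span[OF w(1)] by blast
      show "\<exists>a \<in> f ` B \<rightarrow> carrier K. v = (\<Oplus>\<^bsub>?T\<^esub>b \<in> f ` B. a b \<odot>\<^bsub>?T\<^esub> b)"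
      proof (intro bexI[of _ "\<lambda>b. a (inv_into (carrier E) f b)"])
        show "v = (\<Oplus>\<^bsub>?T\<^esub>b \<in> f ` B. a (inv_into (carrier E) f b) \<odot>\<^bsub>?T\<^esub> b)"
          using sum[OF B a(1)] w(2) a(2) by simp
      qed (use a(1) B(2) g in \<open>auto simp: subset_eq Pi_iff\<close>)
    qed (use B in \<open>auto simp: T\<close>)
  qed
  then have "fin_dim_lie_algebra K ?T"
    using lie by (simp add: fin_dim_lie_algebra_def fin_dim_lie_algebra_axioms_def)
  then show "central_extension K L ?T (\<phi> \<circ> inv_into (carrier E) f)"
    using ext unfolding central_extension_def center
    by (auto simp: lie_hom_def T g image_image)
qed

theorem Z_star_subset:
  fixes K :: "('k, 'c) ring_scheme" and E :: "('k, 'w, 'n) module_scheme"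
  assumes "central_extension K L E \<phi>"
  shows "Z_star K L \<subseteq> \<phi> ` lie_center E"
proof -
  obtain f :: "'w \<Rightarrow> nat \<Rightarrow> 'k" where f: "inj_on f (carrier E)"
    using fin_dim_lie_algebra_inj assms by (metis central_extension_def)
  have "(\<phi> \<circ> inv_into (carrier E) f) ` lie_center (transport f E) = \<phi> ` lie_center E"
    unfolding central_extension_transport(2)[OF assms f] image_image
    using f by (intro image_cong) (auto simp: lie_center_def)
  then show ?thesis
    using central_extension_transport(1)[OF assms f] unfolding Z_star_def by blast
qed

end

theory Submission
  imports Defs
begin

text \<open>
  Both inclusions rest on the fact that \<open>L \<and> L\<close> classifies the brackets of central extensions.

  If \<open>(E, \<phi>)\<close> is a central extension, then a bracket in \<open>E\<close> depends only on the images of its two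
  arguments in \<open>L\<close>, so \<open>l \<and> m \<mapsto> [s l, s m]\<close>, for any section \<open>s\<close> of \<open>\<phi>\<close>, respects the relations of
  the exterior square and defines a homomorphism from \<open>L \<and> L\<close> to \<open>E\<close>
  (\<open>exterior_square_to_central_extension\<close>).  Hence every lift of an element of
  \<open>Z\<^sup>\<and>(L)\<close> is central in \<open>E\<close>.

  Conversely, the relations of \<open>L \<and> L\<close> say that \<open>(x, y) \<mapsto> x \<and> y\<close> is an alternating 2-cocycle on \<open>L\<close>
  with values in the vector space underlying \<open>L \<and> L\<close>.  The corresponding extension on
  \<open>L \<times> (L \<and> L)\<close>, with bracket \<open>[(x, v), (y, w)] = ([x, y], x \<and> y)\<close>, is central, and \<open>(x, v)\<close> can
  lie in its center only if \<open>x \<in> Z\<^sup>\<and>(L)\<close>.  It is finite dimensional because \<open>L \<and> L\<close> is: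
  since \<open>[l \<and> m, l' \<and> m'] = [l, m] \<and> [l', m']\<close>, the elements \<open>b \<and> b'\<close> with \<open>b\<close>, \<open>b'\<close> in
  a finite spanning set of \<open>L\<close> span it linearly (\<open>finite_dim_exterior_square\<close>).
\<close>

section \<open>Linear spans\<close>

text \<open>
  The linear span, generated inductively; this gives an induction principle that the formulation of
  \<open>finite_dim\<close> by finite sums lacks.
\<close>

inductive_set lin_span :: "('k, 'c) ring_scheme \<Rightarrow> ('k, 'v, 'm) module_scheme \<Rightarrow> 'v set \<Rightarrow> 'v set"
  for K :: "('k, 'c) ring_scheme" and M :: "('k, 'v, 'm) module_scheme" and B :: "'v set"
where
  zero: "\<zero>\<^bsub>M\<^esub> \<in> lin_span K M B"
| base: "b \<in> B \<Longrightarrow> b \<in> lin_span K M B"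
| add: "\<lbrakk>x \<in> lin_span K M B; y \<in> lin_span K M B\<rbrakk> \<Longrightarrow> x \<oplus>\<^bsub>M\<^esub> y \<in> lin_span K M B"
| smult: "\<lbrakk>a \<in> carrier K; x \<in> lin_span K M B\<rbrakk> \<Longrightarrow> a \<odot>\<^bsub>M\<^esub> x \<in> lin_span K M B"

context module
begin

lemma lin_span_closed:
  assumes "B \<subseteq> carrier M" "x \<in> lin_span R M B"
  shows "x \<in> carrier M"
  using assms(2,1) by induction auto

lemma finsum_in_lin_span:
  assumes "finite B" "B \<subseteq> carrier M" "a \<in> B \<rightarrow> carrier R"
  shows "(\<Oplus>\<^bsub>M\<^esub>b \<in> B. a b \<odot>\<^bsub>M\<^esub> b) \<in> lin_span R M B"
proof -
  have "(\<Oplus>\<^bsub>M\<^esub>b \<in> C. a b \<odot>\<^bsub>M\<^esub> b) \<in> lin_span R M B" if "C \<subseteq> B" for C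
    using finite_subset[OF that assms(1)] that
  proof (induction C rule: finite_induct)
    case empty
    show ?case by (simp add: lin_span.zero)
  next
    case (insert x C)
    have "(\<lambda>b. a b \<odot>\<^bsub>M\<^esub> b) \<in> C \<rightarrow> carrier M"
      using insert.prems assms by auto
    moreover have x: "a x \<in> carrier R" "x \<in> B"
      using insert.prems assms by auto
    moreover have "a x \<odot>\<^bsub>M\<^esub> x \<in> carrier M"
      using x assms(2) by auto
    ultimately have "(\<Oplus>\<^bsub>M\<^esub>b \<in> insert x C. a b \<odot>\<^bsub>M\<^esub> b) =
        a x \<odot>\<^bsub>M\<^esub> x \<oplus>\<^bsub>M\<^esub> (\<Oplus>\<^bsub>M\<^esub>b \<in> C. a b \<odot>\<^bsub>M\<^esub> b)"
      using insert.hyps by (simp add: M.finsum_insert)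
    moreover have "a x \<odot>\<^bsub>M\<^esub> x \<in> lin_span R M B"
      using x by (intro lin_span.smult lin_span.base)
    ultimately show ?case
      using insert by (auto intro: lin_span.add)
  qed
  then show ?thesis by simp
qed

lemma lin_span_eq_finsum:
  assumes B: "finite B" "B \<subseteq> carrier M" and v: "v \<in> lin_span R M B"
  shows "\<exists>a \<in> B \<rightarrow> carrier R. v = (\<Oplus>\<^bsub>M\<^esub>b \<in> B. a b \<odot>\<^bsub>M\<^esub> b)"
  using v
proof induction
  case zero
  have "(\<Oplus>\<^bsub>M\<^esub>b \<in> B. \<zero>\<^bsub>R\<^esub> \<odot>\<^bsub>M\<^esub> b) = (\<Oplus>\<^bsub>M\<^esub>b \<in> B. \<zero>\<^bsub>M\<^esub>)"
    using B by (intro M.finsum_cong') auto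
  then show ?case
    by (intro bexI[of _ "\<lambda>_. \<zero>\<^bsub>R\<^esub>"]) auto
next
  case (base v)
  have "(\<Oplus>\<^bsub>M\<^esub>b \<in> B. (if b = v then \<one>\<^bsub>R\<^esub> else \<zero>\<^bsub>R\<^esub>) \<odot>\<^bsub>M\<^esub> b) =
      (\<Oplus>\<^bsub>M\<^esub>b \<in> B. if v = b then b else \<zero>\<^bsub>M\<^esub>)"
    using B by (intro M.finsum_cong') auto
  also have "\<dots> = v"
    using B base by (intro M.finsum_singleton) auto
  finally show ?case
    by (intro bexI[of _ "\<lambda>b. if b = v then \<one>\<^bsub>R\<^esub> else \<zero>\<^bsub>R\<^esub>"]) auto
next
  case (add x y)
  then obtain a c where ac: "a \<in> B \<rightarrow> carrier R" "c \<in> B \<rightarrow> carrier R"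
    and "x = (\<Oplus>\<^bsub>M\<^esub>b \<in> B. a b \<odot>\<^bsub>M\<^esub> b)" "y = (\<Oplus>\<^bsub>M\<^esub>b \<in> B. c b \<odot>\<^bsub>M\<^esub> b)"
    by blast
  moreover have "(\<lambda>b. a b \<odot>\<^bsub>M\<^esub> b) \<in> B \<rightarrow> carrier M" "(\<lambda>b. c b \<odot>\<^bsub>M\<^esub> b) \<in> B \<rightarrow> carrier M"
    using ac B by auto
  ultimately have "x \<oplus>\<^bsub>M\<^esub> y = (\<Oplus>\<^bsub>M\<^esub>b \<in> B. a b \<odot>\<^bsub>M\<^esub> b \<oplus>\<^bsub>M\<^esub> c b \<odot>\<^bsub>M\<^esub> b)"
    by (simp add: M.finsum_addf)
  also have "\<dots> = (\<Oplus>\<^bsub>M\<^esub>b \<in> B. (a b \<oplus>\<^bsub>R\<^esub> c b) \<odot>\<^bsub>M\<^esub> b)"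
    using ac B by (intro M.finsum_cong') (auto simp: smult_l_distr Pi_iff subset_eq)
  finally show ?case
    using ac by (intro bexI[of _ "\<lambda>b. a b \<oplus>\<^bsub>R\<^esub> c b"]) auto
next
  case (smult k x)
  then obtain a where a: "a \<in> B \<rightarrow> carrier R" "x = (\<Oplus>\<^bsub>M\<^esub>b \<in> B. a b \<odot>\<^bsub>M\<^esub> b)"
    by blast
  have "k \<odot>\<^bsub>M\<^esub> x = (\<Oplus>\<^bsub>M\<^esub>b \<in> B. k \<odot>\<^bsub>M\<^esub> (a b \<odot>\<^bsub>M\<^esub> b))"
    unfolding a(2) using a(1) B smult.hyps by (intro finsum_smult_ldistr) auto
  also have "\<dots> = (\<Oplus>\<^bsub>M\<^esub>b \<in> B. (k \<otimes>\<^bsub>R\<^esub> a b) \<odot>\<^bsub>M\<^esub> b)"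
    using a B smult.hyps by (intro M.finsum_cong') (auto simp: smult_assoc1 Pi_iff subset_eq)
  finally show ?case
    using a smult.hyps by (intro bexI[of _ "\<lambda>b. k \<otimes>\<^bsub>R\<^esub> a b"]) auto
qed

lemma finite_dim_iff_lin_span:
  "finite_dim R M \<longleftrightarrow> (\<exists>B. finite B \<and> B \<subseteq> carrier M \<and> carrier M \<subseteq> lin_span R M B)"
proof -
  have "(\<exists>a \<in> B \<rightarrow> carrier R. v = (\<Oplus>\<^bsub>M\<^esub>b \<in> B. a b \<odot>\<^bsub>M\<^esub> b)) \<longleftrightarrow> v \<in> lin_span R M B"
    if "finite B" "B \<subseteq> carrier M" for B v
    using finsum_in_lin_span[OF that] lin_span_eq_finsum[OF that] by blast
  then show ?thesis
    unfolding finite_dim_def subset_iff[of "carrier M"] Ball_def by (intro ex_cong1) blast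
qed

end


section \<open>Identities in a Lie algebra\<close>

context lie_algebra
begin

lemma minus_one_smult:
  "x \<in> carrier L \<Longrightarrow> (\<ominus>\<^bsub>K\<^esub> \<one>\<^bsub>K\<^esub>) \<odot>\<^bsub>L\<^esub> x = \<ominus>\<^bsub>L\<^esub> x"
  by (simp add: smult_l_minus)

lemma eq_if_diff_zero:
  assumes "x \<in> carrier L" "y \<in> carrier L" "x \<ominus>\<^bsub>L\<^esub> y = \<zero>\<^bsub>L\<^esub>"
  shows "x = y"
  using M.minus_equality[of x "\<ominus>\<^bsub>L\<^esub> y"] assms by (simp add: a_minus_def)

lemma bracket_zero_left: "x \<in> carrier L \<Longrightarrow> \<zero>\<^bsub>L\<^esub> \<otimes>\<^bsub>L\<^esub> x = \<zero>\<^bsub>L\<^esub>"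
  using bracket_smult_left[of "\<zero>\<^bsub>K\<^esub>" x x] by auto

lemma bracket_zero_right: "x \<in> carrier L \<Longrightarrow> x \<otimes>\<^bsub>L\<^esub> \<zero>\<^bsub>L\<^esub> = \<zero>\<^bsub>L\<^esub>"
  using bracket_smult_right[of "\<zero>\<^bsub>K\<^esub>" x x] by auto

lemma bracket_uminus_left:
  assumes "x \<in> carrier L" "y \<in> carrier L"
  shows "(\<ominus>\<^bsub>L\<^esub> x) \<otimes>\<^bsub>L\<^esub> y = \<ominus>\<^bsub>L\<^esub> (x \<otimes>\<^bsub>L\<^esub> y)"
  using bracket_smult_left[of "\<ominus>\<^bsub>K\<^esub> \<one>\<^bsub>K\<^esub>" x y] assms by (simp add: minus_one_smult)

lemma bracket_uminus_right:
  assumes "x \<in> carrier L" "y \<in> carrier L"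
  shows "x \<otimes>\<^bsub>L\<^esub> (\<ominus>\<^bsub>L\<^esub> y) = \<ominus>\<^bsub>L\<^esub> (x \<otimes>\<^bsub>L\<^esub> y)"
  using bracket_smult_right[of "\<ominus>\<^bsub>K\<^esub> \<one>\<^bsub>K\<^esub>" x y] assms by (simp add: minus_one_smult)

lemma bracket_antisym:
  assumes x: "x \<in> carrier L" and y: "y \<in> carrier L"
  shows "y \<otimes>\<^bsub>L\<^esub> x = \<ominus>\<^bsub>L\<^esub> (x \<otimes>\<^bsub>L\<^esub> y)"
proof -
  have "(x \<oplus>\<^bsub>L\<^esub> y) \<otimes>\<^bsub>L\<^esub> (x \<oplus>\<^bsub>L\<^esub> y) = x \<otimes>\<^bsub>L\<^esub> y \<oplus>\<^bsub>L\<^esub> y \<otimes>\<^bsub>L\<^esub> x"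
    using assms by (simp add: bracket_add_left bracket_add_right bracket_self[of x] bracket_self[of y] M.a_ac)
  moreover have "(x \<oplus>\<^bsub>L\<^esub> y) \<otimes>\<^bsub>L\<^esub> (x \<oplus>\<^bsub>L\<^esub> y) = \<zero>\<^bsub>L\<^esub>"
    using assms by (intro bracket_self) auto
  ultimately have "y \<otimes>\<^bsub>L\<^esub> x \<oplus>\<^bsub>L\<^esub> x \<otimes>\<^bsub>L\<^esub> y = \<zero>\<^bsub>L\<^esub>"
    using assms by (simp add: M.a_comm)
  then show ?thesis
    using assms by (simp add: M.minus_equality)
qed

lemma bracket_bracket_left:
  assumes "x \<in> carrier L" "y \<in> carrier L" "z \<in> carrier L"
  shows "(x \<otimes>\<^bsub>L\<^esub> y) \<otimes>\<^bsub>L\<^esub> z = x \<otimes>\<^bsub>L\<^esub> (y \<otimes>\<^bsub>L\<^esub> z) \<ominus>\<^bsub>L\<^esub> y \<otimes>\<^bsub>L\<^esub> (x \<otimes>\<^bsub>L\<^esub> z)"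
proof -
  have "y \<otimes>\<^bsub>L\<^esub> (z \<otimes>\<^bsub>L\<^esub> x) = \<ominus>\<^bsub>L\<^esub> (y \<otimes>\<^bsub>L\<^esub> (x \<otimes>\<^bsub>L\<^esub> z))"
    using assms by (simp add: bracket_antisym[of x z] bracket_uminus_right)
  moreover have "z \<otimes>\<^bsub>L\<^esub> (x \<otimes>\<^bsub>L\<^esub> y) = \<ominus>\<^bsub>L\<^esub> ((x \<otimes>\<^bsub>L\<^esub> y) \<otimes>\<^bsub>L\<^esub> z)"
    using assms by (intro bracket_antisym) auto
  ultimately have "(x \<otimes>\<^bsub>L\<^esub> (y \<otimes>\<^bsub>L\<^esub> z) \<ominus>\<^bsub>L\<^esub> y \<otimes>\<^bsub>L\<^esub> (x \<otimes>\<^bsub>L\<^esub> z)) \<ominus>\<^bsub>L\<^esub> (x \<otimes>\<^bsub>L\<^esub> y) \<otimes>\<^bsub>L\<^esub> z = \<zero>\<^bsub>L\<^esub>"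
    using jacobi[OF assms] by (simp add: a_minus_def)
  then show ?thesis
    by (rule eq_if_diff_zero[symmetric, rotated 2]) (use assms in auto)
qed

lemma bracket_bracket_right:
  assumes "x \<in> carrier L" "y \<in> carrier L" "z \<in> carrier L"
  shows "x \<otimes>\<^bsub>L\<^esub> (y \<otimes>\<^bsub>L\<^esub> z) = (z \<otimes>\<^bsub>L\<^esub> x) \<otimes>\<^bsub>L\<^esub> y \<ominus>\<^bsub>L\<^esub> (y \<otimes>\<^bsub>L\<^esub> x) \<otimes>\<^bsub>L\<^esub> z"
proof -
  have "x \<otimes>\<^bsub>L\<^esub> (y \<otimes>\<^bsub>L\<^esub> z) = \<ominus>\<^bsub>L\<^esub> ((y \<otimes>\<^bsub>L\<^esub> z) \<otimes>\<^bsub>L\<^esub> x)"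
    using assms by (intro bracket_antisym) auto
  also have "\<dots> = \<ominus>\<^bsub>L\<^esub> (y \<otimes>\<^bsub>L\<^esub> (z \<otimes>\<^bsub>L\<^esub> x)) \<oplus>\<^bsub>L\<^esub> z \<otimes>\<^bsub>L\<^esub> (y \<otimes>\<^bsub>L\<^esub> x)"
    using assms by (simp add: bracket_bracket_left[of y z x] a_minus_def M.minus_add)
  also have "\<ominus>\<^bsub>L\<^esub> (y \<otimes>\<^bsub>L\<^esub> (z \<otimes>\<^bsub>L\<^esub> x)) = (z \<otimes>\<^bsub>L\<^esub> x) \<otimes>\<^bsub>L\<^esub> y"
    using assms by (intro bracket_antisym[symmetric]) auto
  also have "z \<otimes>\<^bsub>L\<^esub> (y \<otimes>\<^bsub>L\<^esub> x) = \<ominus>\<^bsub>L\<^esub> ((y \<otimes>\<^bsub>L\<^esub> x) \<otimes>\<^bsub>L\<^esub> z)"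
    using assms by (intro bracket_antisym) auto
  finally show ?thesis
    by (simp add: a_minus_def)
qed

end


section \<open>Extensions by a cocycle\<close>

text \<open>
  The extension of \<open>L\<close> by the vector space \<open>V\<close> given by a map \<open>\<beta> : L \<times> L \<rightarrow> V\<close>.  A bracket that \<open>V\<close>
  may carry is ignored: \<open>V\<close> becomes a central, hence abelian, ideal.
\<close>

definition cocycle_extension ::
  "('k, 'v, 'm) module_scheme \<Rightarrow> ('k, 'w, 'n) module_scheme \<Rightarrow> ('v \<Rightarrow> 'v \<Rightarrow> 'w) \<Rightarrow> ('k, 'v \<times> 'w) module"
where
  "cocycle_extension L V \<beta> =
    \<lparr>carrier = carrier L \<times> carrier V,
     mult = (\<lambda>p q. (fst p \<otimes>\<^bsub>L\<^esub> fst q, \<beta> (fst p) (fst q))),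
     one = undefined,
     zero = (\<zero>\<^bsub>L\<^esub>, \<zero>\<^bsub>V\<^esub>),
     add = (\<lambda>p q. (fst p \<oplus>\<^bsub>L\<^esub> fst q, snd p \<oplus>\<^bsub>V\<^esub> snd q)),
     smult = (\<lambda>a p. (a \<odot>\<^bsub>L\<^esub> fst p, a \<odot>\<^bsub>V\<^esub> snd p))\<rparr>"

lemma cocycle_extension_simps:
  "carrier (cocycle_extension L V \<beta>) = carrier L \<times> carrier V"
  "\<zero>\<^bsub>cocycle_extension L V \<beta>\<^esub> = (\<zero>\<^bsub>L\<^esub>, \<zero>\<^bsub>V\<^esub>)"
  "(x, v) \<otimes>\<^bsub>cocycle_extension L V \<beta>\<^esub> (y, w) = (x \<otimes>\<^bsub>L\<^esub> y, \<beta> x y)"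
  "(x, v) \<oplus>\<^bsub>cocycle_extension L V \<beta>\<^esub> (y, w) = (x \<oplus>\<^bsub>L\<^esub> y, v \<oplus>\<^bsub>V\<^esub> w)"
  "a \<odot>\<^bsub>cocycle_extension L V \<beta>\<^esub> (x, v) = (a \<odot>\<^bsub>L\<^esub> x, a \<odot>\<^bsub>V\<^esub> v)"
  by (simp_all add: cocycle_extension_def)

text \<open>
  Alternating bilinear 2-cocycles on \<open>L\<close> with values in the vector space \<open>V\<close>, on which \<open>L\<close> acts
  trivially.
\<close>

locale lie_cocycle = lie_algebra K L + V: module K V
  for K (structure) and L (structure) and V (structure) +
  fixes \<beta>
  assumes cocycle_closed [simp, intro]:
      "\<lbrakk>x \<in> carrier L; y \<in> carrier L\<rbrakk> \<Longrightarrow> \<beta> x y \<in> carrier V"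
    and cocycle_add_left:
      "\<lbrakk>x \<in> carrier L; y \<in> carrier L; z \<in> carrier L\<rbrakk> \<Longrightarrow> \<beta> (x \<oplus>\<^bsub>L\<^esub> y) z = \<beta> x z \<oplus>\<^bsub>V\<^esub> \<beta> y z"
    and cocycle_add_right:
      "\<lbrakk>x \<in> carrier L; y \<in> carrier L; z \<in> carrier L\<rbrakk> \<Longrightarrow> \<beta> x (y \<oplus>\<^bsub>L\<^esub> z) = \<beta> x y \<oplus>\<^bsub>V\<^esub> \<beta> x z"
    and cocycle_smult_left:
      "\<lbrakk>a \<in> carrier K; x \<in> carrier L; y \<in> carrier L\<rbrakk> \<Longrightarrow> \<beta> (a \<odot>\<^bsub>L\<^esub> x) y = a \<odot>\<^bsub>V\<^esub> \<beta> x y"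
    and cocycle_smult_right:
      "\<lbrakk>a \<in> carrier K; x \<in> carrier L; y \<in> carrier L\<rbrakk> \<Longrightarrow> \<beta> x (a \<odot>\<^bsub>L\<^esub> y) = a \<odot>\<^bsub>V\<^esub> \<beta> x y"
    and cocycle_self: "x \<in> carrier L \<Longrightarrow> \<beta> x x = \<zero>\<^bsub>V\<^esub>"
    and cocycle_jacobi:
      "\<lbrakk>x \<in> carrier L; y \<in> carrier L; z \<in> carrier L\<rbrakk> \<Longrightarrow>
        \<beta> x (y \<otimes>\<^bsub>L\<^esub> z) \<oplus>\<^bsub>V\<^esub> \<beta> y (z \<otimes>\<^bsub>L\<^esub> x) \<oplus>\<^bsub>V\<^esub> \<beta> z (x \<otimes>\<^bsub>L\<^esub> y) = \<zero>\<^bsub>V\<^esub>"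
begin

lemma cocycle_zero_left: "x \<in> carrier L \<Longrightarrow> \<beta> \<zero>\<^bsub>L\<^esub> x = \<zero>\<^bsub>V\<^esub>"
  using cocycle_smult_left[of "\<zero>\<^bsub>K\<^esub>" x x] by auto

lemma cocycle_zero_right: "x \<in> carrier L \<Longrightarrow> \<beta> x \<zero>\<^bsub>L\<^esub> = \<zero>\<^bsub>V\<^esub>"
  using cocycle_smult_right[of "\<zero>\<^bsub>K\<^esub>" x x] by auto

lemma lie_algebra_cocycle_extension: "lie_algebra K (cocycle_extension L V \<beta>)"
proof -
  let ?E = "cocycle_extension L V \<beta>"
  note simps = cocycle_extension_simps
  have grp: "abelian_group ?E"
  proof (rule abelian_groupI)
    fix p assume "p \<in> carrier ?E"
    then show "\<exists>q \<in> carrier ?E. q \<oplus>\<^bsub>?E\<^esub> p = \<zero>\<^bsub>?E\<^esub>"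
      by (intro bexI[of _ "(\<ominus>\<^bsub>L\<^esub> fst p, \<ominus>\<^bsub>V\<^esub> snd p)"]) (auto simp: simps M.l_neg V.M.l_neg)
  qed (auto simp: simps M.a_ac V.M.a_ac)
  have "module K ?E"
    by (rule moduleI[OF K.is_cring grp])
      (auto simp: simps smult_l_distr smult_r_distr smult_assoc1
        V.smult_l_distr V.smult_r_distr V.smult_assoc1)
  then show ?thesis
    by (intro lie_algebra.intro lie_algebra_axioms.intro K.field_axioms)
      (auto simp: simps bracket_add_left bracket_add_right bracket_smult_left bracket_smult_right
        bracket_self jacobi cocycle_add_left cocycle_add_right cocycle_smult_left
        cocycle_smult_right cocycle_self cocycle_jacobi)
qed

lemma finite_dim_cocycle_extension:
  assumes "finite_dim K L" "finite_dim K V"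
  shows "finite_dim K (cocycle_extension L V \<beta>)"
proof -
  let ?E = "cocycle_extension L V \<beta>"
  interpret E: lie_algebra K ?E by (rule lie_algebra_cocycle_extension)
  obtain B where B: "finite B" "B \<subseteq> carrier L" "carrier L \<subseteq> lin_span K L B"
    using assms(1) unfolding finite_dim_iff_lin_span by blast
  obtain C where C: "finite C" "C \<subseteq> carrier V" "carrier V \<subseteq> lin_span K V C"
    using assms(2) unfolding V.finite_dim_iff_lin_span by blast
  let ?D = "(\<lambda>b. (b, \<zero>\<^bsub>V\<^esub>)) ` B \<union> (\<lambda>c. (\<zero>\<^bsub>L\<^esub>, c)) ` C"
  have D: "finite ?D" "?D \<subseteq> carrier ?E"
    using B C by (auto simp: cocycle_extension_simps)
  have L: "(x, \<zero>\<^bsub>V\<^esub>) \<in> lin_span K ?E ?D" if "x \<in> lin_span K L B" for x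
    using that
  proof induction
    case zero
    show ?case using lin_span.zero[of ?E K ?D] by (simp add: cocycle_extension_simps)
  next
    case (add x y)
    then show ?case
      using lin_span.add[OF add.IH] by (simp add: cocycle_extension_simps)
  next
    case (smult a x)
    then show ?case
      using lin_span.smult[OF smult.hyps(1) smult.IH] by (simp add: cocycle_extension_simps)
  qed (auto intro: lin_span.base)
  have V: "(\<zero>\<^bsub>L\<^esub>, v) \<in> lin_span K ?E ?D" if "v \<in> lin_span K V C" for v
    using that
  proof induction
    case zero
    show ?case using lin_span.zero[of ?E K ?D] by (simp add: cocycle_extension_simps)
  next
    case (add x y)
    then show ?case
      using lin_span.add[OF add.IH] by (simp add: cocycle_extension_simps)
  next
    case (smult a x)
    then show ?case
      using lin_span.smult[OF smult.hyps(1) smult.IH] by (simp add: cocycle_extension_simps)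
  qed (auto intro: lin_span.base)
  have "(x, v) \<in> lin_span K ?E ?D" if "x \<in> carrier L" "v \<in> carrier V" for x v
    using lin_span.add[OF L V, of x v] B(3) C(3) that by (auto simp: cocycle_extension_simps)
  then have "carrier ?E \<subseteq> lin_span K ?E ?D"
    by (auto simp: cocycle_extension_simps)
  then show ?thesis
    unfolding E.finite_dim_iff_lin_span using D by blast
qed

lemma central_extension_cocycle_extension:
  assumes "finite_dim K L" "finite_dim K V"
  shows "central_extension K L (cocycle_extension L V \<beta>) fst"
  unfolding central_extension_def fin_dim_lie_algebra_def fin_dim_lie_algebra_axioms_def
  using finite_dim_cocycle_extension[OF assms] lie_algebra_cocycle_extension
  by (auto simp: lie_hom_def lie_center_def cocycle_extension_simps cocycle_zero_left
      bracket_zero_left)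

end


section \<open>The exterior square\<close>

context lie_algebra
begin

lemma lie_algebra_exterior_square: "lie_algebra K (exterior_square K L)"
  unfolding exterior_square_def by (rule lie_algebra_lie_presentation[OF K.field_axioms])

lemma wedge_closed [simp, intro]:
  "\<lbrakk>x \<in> carrier L; y \<in> carrier L\<rbrakk> \<Longrightarrow> wedge K L x y \<in> carrier (exterior_square K L)"
  by (auto simp: wedge_def exterior_square_def lie_presentation_carrier intro!: lie_terms.gen)

lemma wedge_relation_eq:
  assumes "(s, t) \<in> wedge_relations K L"
    and "s \<in> lie_terms K (carrier L \<times> carrier L)" "t \<in> lie_terms K (carrier L \<times> carrier L)"
  shows "lie_class K (carrier L \<times> carrier L) (wedge_relations K L) s =
    lie_class K (carrier L \<times> carrier L) (wedge_relations K L) t"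
  using assms by (intro lie_class_eqI lie_cong.rel)

lemma smult_lie_class:
  "\<lbrakk>a \<in> carrier K; t \<in> lie_terms K X\<rbrakk> \<Longrightarrow>
    a \<odot>\<^bsub>lie_presentation K X R\<^esub> lie_class K X R t = lie_class K X R (TSmult a t)"
  by (intro lie_presentation_simps(3)) auto

lemmas wedge_simps = wedge_def exterior_square_def lie_presentation_simps(1,2) smult_lie_class
  lie_presentation_zero lie_terms.intros

lemma wedge_add_left:
  "\<lbrakk>x \<in> carrier L; y \<in> carrier L; z \<in> carrier L\<rbrakk> \<Longrightarrow>
    wedge K L (x \<oplus>\<^bsub>L\<^esub> y) z = wedge K L x z \<oplus>\<^bsub>exterior_square K L\<^esub> wedge K L y z"
  using wedge_relation_eq[OF wedge_relations.wedge_add_left[of x L y z K]]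
  by (simp add: wedge_simps)

lemma wedge_add_right:
  "\<lbrakk>x \<in> carrier L; y \<in> carrier L; z \<in> carrier L\<rbrakk> \<Longrightarrow>
    wedge K L x (y \<oplus>\<^bsub>L\<^esub> z) = wedge K L x y \<oplus>\<^bsub>exterior_square K L\<^esub> wedge K L x z"
  using wedge_relation_eq[OF wedge_relations.wedge_add_right[of x L y z K]]
  by (simp add: wedge_simps)

lemma wedge_smult_left:
  "\<lbrakk>a \<in> carrier K; x \<in> carrier L; y \<in> carrier L\<rbrakk> \<Longrightarrow>
    wedge K L (a \<odot>\<^bsub>L\<^esub> x) y = a \<odot>\<^bsub>exterior_square K L\<^esub> wedge K L x y"
  using wedge_relation_eq[OF wedge_relations.wedge_smult_left[of a K x L y]]
  by (simp add: wedge_simps)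

lemma wedge_smult_right:
  "\<lbrakk>a \<in> carrier K; x \<in> carrier L; y \<in> carrier L\<rbrakk> \<Longrightarrow>
    wedge K L x (a \<odot>\<^bsub>L\<^esub> y) = a \<odot>\<^bsub>exterior_square K L\<^esub> wedge K L x y"
  using wedge_relation_eq[OF wedge_relations.wedge_smult_right[of a K x L y]]
  by (simp add: wedge_simps)

lemma wedge_self: "x \<in> carrier L \<Longrightarrow> wedge K L x x = \<zero>\<^bsub>exterior_square K L\<^esub>"
  using wedge_relation_eq[OF wedge_relations.wedge_self[of x L K]]
  by (simp add: wedge_simps)

lemma bracket_wedge:
  "\<lbrakk>x \<in> carrier L; y \<in> carrier L; x' \<in> carrier L; y' \<in> carrier L\<rbrakk> \<Longrightarrow>
    wedge K L x y \<otimes>\<^bsub>exterior_square K L\<^esub> wedge K L x' y' = wedge K L (x \<otimes>\<^bsub>L\<^esub> y) (x' \<otimes>\<^bsub>L\<^esub> y')"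
  using wedge_relation_eq[OF wedge_relations.bracket_wedge[of x L y x' y' K]]
  by (simp add: wedge_simps)

lemma wedge_bracket_left:
  assumes "x \<in> carrier L" "y \<in> carrier L" "z \<in> carrier L"
  shows "wedge K L (x \<otimes>\<^bsub>L\<^esub> y) z =
    wedge K L x (y \<otimes>\<^bsub>L\<^esub> z) \<ominus>\<^bsub>exterior_square K L\<^esub> wedge K L y (x \<otimes>\<^bsub>L\<^esub> z)"
proof -
  interpret W: lie_algebra K "exterior_square K L" by (rule lie_algebra_exterior_square)
  have "\<ominus>\<^bsub>K\<^esub> \<one>\<^bsub>K\<^esub> \<in> carrier K" by simp
  then have "wedge K L (x \<otimes>\<^bsub>L\<^esub> y) z = wedge K L x (y \<otimes>\<^bsub>L\<^esub> z) \<oplus>\<^bsub>exterior_square K L\<^esub>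
      (\<ominus>\<^bsub>K\<^esub> \<one>\<^bsub>K\<^esub>) \<odot>\<^bsub>exterior_square K L\<^esub> wedge K L y (x \<otimes>\<^bsub>L\<^esub> z)"
    using wedge_relation_eq[OF wedge_relations.wedge_bracket_left[of x L y z K]] assms
    by (simp add: wedge_simps)
  then show ?thesis
    using assms by (simp add: W.minus_one_smult a_minus_def)
qed

lemma wedge_antisym:
  assumes x: "x \<in> carrier L" and y: "y \<in> carrier L"
  shows "wedge K L y x = \<ominus>\<^bsub>exterior_square K L\<^esub> wedge K L x y"
proof -
  interpret W: lie_algebra K "exterior_square K L" by (rule lie_algebra_exterior_square)
  have "wedge K L (x \<oplus>\<^bsub>L\<^esub> y) (x \<oplus>\<^bsub>L\<^esub> y) =
      wedge K L x y \<oplus>\<^bsub>exterior_square K L\<^esub> wedge K L y x"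
    using assms by (simp add: wedge_add_left wedge_add_right wedge_self[of x] wedge_self[of y] W.M.a_ac)
  moreover have "wedge K L (x \<oplus>\<^bsub>L\<^esub> y) (x \<oplus>\<^bsub>L\<^esub> y) = \<zero>\<^bsub>exterior_square K L\<^esub>"
    using assms by (intro wedge_self) auto
  ultimately have "wedge K L y x \<oplus>\<^bsub>exterior_square K L\<^esub> wedge K L x y = \<zero>\<^bsub>exterior_square K L\<^esub>"
    using assms by (simp add: W.M.a_comm)
  then show ?thesis
    using assms by (simp add: W.M.minus_equality)
qed

lemma wedge_uminus_right:
  assumes x: "x \<in> carrier L" and y: "y \<in> carrier L"
  shows "wedge K L x (\<ominus>\<^bsub>L\<^esub> y) = \<ominus>\<^bsub>exterior_square K L\<^esub> wedge K L x y"
proof -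
  interpret W: lie_algebra K "exterior_square K L" by (rule lie_algebra_exterior_square)
  show ?thesis
    using wedge_smult_right[of "\<ominus>\<^bsub>K\<^esub> \<one>\<^bsub>K\<^esub>" x y] assms
    by (simp add: minus_one_smult W.minus_one_smult)
qed

lemma lie_cocycle_wedge: "lie_cocycle K L (exterior_square K L) (wedge K L)"
proof -
  interpret W: lie_algebra K "exterior_square K L" by (rule lie_algebra_exterior_square)
  show ?thesis
  proof (intro lie_cocycle.intro lie_cocycle_axioms.intro)
    fix x y z assume xyz: "x \<in> carrier L" "y \<in> carrier L" "z \<in> carrier L"
    have "wedge K L z (x \<otimes>\<^bsub>L\<^esub> y) = \<ominus>\<^bsub>exterior_square K L\<^esub> wedge K L (x \<otimes>\<^bsub>L\<^esub> y) z"
      using xyz by (intro wedge_antisym) auto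
    moreover have "wedge K L y (z \<otimes>\<^bsub>L\<^esub> x) = \<ominus>\<^bsub>exterior_square K L\<^esub> wedge K L y (x \<otimes>\<^bsub>L\<^esub> z)"
      using xyz by (simp add: bracket_antisym[of x z] wedge_uminus_right)
    moreover have "wedge K L (x \<otimes>\<^bsub>L\<^esub> y) z =
        wedge K L x (y \<otimes>\<^bsub>L\<^esub> z) \<ominus>\<^bsub>exterior_square K L\<^esub> wedge K L y (x \<otimes>\<^bsub>L\<^esub> z)"
      using xyz by (intro wedge_bracket_left)
    ultimately show "wedge K L x (y \<otimes>\<^bsub>L\<^esub> z) \<oplus>\<^bsub>exterior_square K L\<^esub> wedge K L y (z \<otimes>\<^bsub>L\<^esub> x)
        \<oplus>\<^bsub>exterior_square K L\<^esub> wedge K L z (x \<otimes>\<^bsub>L\<^esub> y) = \<zero>\<^bsub>exterior_square K L\<^esub>"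
      using xyz by (simp add: a_minus_def W.M.r_neg)
  qed (auto simp: wedge_add_left wedge_add_right wedge_smult_left wedge_smult_right wedge_self
      lie_algebra_axioms W.module_axioms)
qed

text \<open>
  The span of the elements \<open>x \<and> y\<close> is closed under the bracket, hence all of the exterior square.
\<close>

lemma exterior_square_span:
  "carrier (exterior_square K L) \<subseteq>
    lin_span K (exterior_square K L) {wedge K L x y | x y. x \<in> carrier L \<and> y \<in> carrier L}"
    (is "carrier ?W \<subseteq> lin_span K ?W ?G")
proof -
  interpret W: lie_algebra K ?W by (rule lie_algebra_exterior_square)
  have G: "?G \<subseteq> carrier ?W" by auto
  note closed = W.lin_span_closed[OF G]
  have bracket_gen: "g \<otimes>\<^bsub>?W\<^esub> w \<in> lin_span K ?W ?G" if g: "g \<in> ?G" and w: "w \<in> lin_span K ?W ?G" for g w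
    using w
  proof induction
    case zero
    then show ?case using g G W.bracket_zero_right by (auto intro: lin_span.zero)
  next
    case (base w)
    then show ?case using g bracket_wedge by (auto intro!: lin_span.base) blast
  next
    case (add v w)
    then show ?case using g G closed by (auto simp: W.bracket_add_right intro: lin_span.add)
  next
    case (smult a w)
    then show ?case using g G closed by (auto simp: W.bracket_smult_right intro: lin_span.smult)
  qed
  have bracket: "v \<otimes>\<^bsub>?W\<^esub> w \<in> lin_span K ?W ?G"
    if v: "v \<in> lin_span K ?W ?G" and w: "w \<in> lin_span K ?W ?G" for v w
    using v
  proof induction
    case zero
    then show ?case using w closed W.bracket_zero_left by (auto intro: lin_span.zero)
  next
    case (base v)
    then show ?case using w bracket_gen by blast
  next
    case (add u v)
    then show ?case using w closed by (auto simp: W.bracket_add_left intro: lin_span.add)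
  next
    case (smult a v)
    then show ?case using w closed by (auto simp: W.bracket_smult_left intro: lin_span.smult)
  qed
  have "lie_class K (carrier L \<times> carrier L) (wedge_relations K L) t \<in> lin_span K ?W ?G"
    if "t \<in> lie_terms K (carrier L \<times> carrier L)" for t
    using that
  proof induction
    case zero
    show ?case
      using lin_span.zero[of ?W K ?G] by (simp add: exterior_square_def lie_presentation_zero)
  next
    case (gen p)
    then show ?case by (auto simp: wedge_def intro!: lin_span.base)
  next
    case (add s t)
    then show ?case
      using lin_span.add[OF add.IH] by (simp add: exterior_square_def lie_presentation_simps)
  next
    case (smult a t)
    then show ?case
      using lin_span.smult[OF smult.hyps(1) smult.IH]
      by (simp add: exterior_square_def lie_presentation_simps)
  next
    case (br s t)
    then show ?case
      using bracket[OF br.IH] by (simp add: exterior_square_def lie_presentation_simps)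
  qed
  then show ?thesis
    unfolding exterior_square_def lie_presentation_carrier by blast
qed

lemma finite_dim_exterior_square:
  assumes "finite_dim K L"
  shows "finite_dim K (exterior_square K L)"
proof -
  let ?W = "exterior_square K L"
  interpret W: lie_algebra K ?W by (rule lie_algebra_exterior_square)
  interpret lie_cocycle K L ?W "wedge K L" by (rule lie_cocycle_wedge)
  obtain B where B: "finite B" "B \<subseteq> carrier L" "carrier L \<subseteq> lin_span K L B"
    using assms unfolding finite_dim_iff_lin_span by blast
  let ?C = "(\<lambda>(b, b'). wedge K L b b') ` (B \<times> B)"
  have C: "finite ?C" "?C \<subseteq> carrier ?W"
    using B by auto
  note closed = lin_span_closed[OF B(2)]
  have wedge_base: "wedge K L b y \<in> lin_span K ?W ?C" if b: "b \<in> B" and y: "y \<in> lin_span K L B" for b y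
    using y
  proof induction
    case zero
    have "b \<in> carrier L" using b B(2) by blast
    then show ?case by (simp add: cocycle_zero_right lin_span.zero)
  next
    case (base b')
    then show ?case using b by (auto intro!: lin_span.base)
  next
    case (add x y)
    have "b \<in> carrier L" using b B(2) by blast
    then show ?case
      using add.IH closed[OF add.hyps(1)] closed[OF add.hyps(2)]
      by (simp add: cocycle_add_right lin_span.add)
  next
    case (smult a x)
    have "b \<in> carrier L" using b B(2) by blast
    then show ?case
      using smult.IH smult.hyps(1) closed[OF smult.hyps(2)]
      by (simp add: cocycle_smult_right lin_span.smult)
  qed
  have wedge: "wedge K L x y \<in> lin_span K ?W ?C"
    if x: "x \<in> lin_span K L B" and y: "y \<in> lin_span K L B" for x y
    using x
  proof induction
    case zero
    show ?case using closed[OF y] by (simp add: cocycle_zero_left lin_span.zero)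
  next
    case (base b)
    then show ?case using y wedge_base by blast
  next
    case (add x x')
    then show ?case
      using closed[OF y] closed[OF add.hyps(1)] closed[OF add.hyps(2)]
      by (simp add: cocycle_add_left lin_span.add)
  next
    case (smult a x)
    then show ?case
      using closed[OF y] closed[OF smult.hyps(2)]
      by (simp add: cocycle_smult_left lin_span.smult)
  qed
  have "w \<in> lin_span K ?W ?C"
    if "w \<in> lin_span K ?W {wedge K L x y | x y. x \<in> carrier L \<and> y \<in> carrier L}" for w
    using that by induction (use wedge B(3) in \<open>auto intro: lin_span.intros\<close>)
  then show ?thesis
    unfolding W.finite_dim_iff_lin_span using C exterior_square_span by blast
qed

text \<open>
  The homomorphism into a central extension \<open>E\<close> that sends \<open>l \<and> m\<close> to the common bracket of all
  pairs of lifts of \<open>l\<close> and \<open>m\<close>.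
\<close>

lemma exterior_square_to_central_extension:
  assumes ext: "central_extension K L E \<phi>"
  shows "\<exists>\<psi> \<in> lie_hom K (exterior_square K L) E.
    \<forall>x \<in> carrier E. \<forall>y \<in> carrier E. \<psi> (wedge K L (\<phi> x) (\<phi> y)) = x \<otimes>\<^bsub>E\<^esub> y"
proof -
  interpret E: fin_dim_lie_algebra K E
    using ext by (simp add: central_extension_def)
  have \<phi>_closed: "\<phi> x \<in> carrier L" if "x \<in> carrier E" for x
    using ext that by (auto simp: central_extension_def lie_hom_def)
  have \<phi>: "\<And>x y. \<lbrakk>x \<in> carrier E; y \<in> carrier E\<rbrakk> \<Longrightarrow> \<phi> (x \<oplus>\<^bsub>E\<^esub> y) = \<phi> x \<oplus>\<^bsub>L\<^esub> \<phi> y"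
    "\<And>a x. \<lbrakk>a \<in> carrier K; x \<in> carrier E\<rbrakk> \<Longrightarrow> \<phi> (a \<odot>\<^bsub>E\<^esub> x) = a \<odot>\<^bsub>L\<^esub> \<phi> x"
    "\<And>x y. \<lbrakk>x \<in> carrier E; y \<in> carrier E\<rbrakk> \<Longrightarrow> \<phi> (x \<otimes>\<^bsub>E\<^esub> y) = \<phi> x \<otimes>\<^bsub>L\<^esub> \<phi> y"
    using ext by (auto simp: central_extension_def lie_hom_def)
  define s where "s = inv_into (carrier E) \<phi>"
  have s: "s l \<in> carrier E" "\<phi> (s l) = l" if "l \<in> carrier L" for l
    using ext that unfolding s_def central_extension_def
    by (metis inv_into_into, metis f_inv_into_f)
  have left: "x \<otimes>\<^bsub>E\<^esub> y = x' \<otimes>\<^bsub>E\<^esub> y"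
    if x: "x \<in> carrier E" "x' \<in> carrier E" "y \<in> carrier E" and eq: "\<phi> x = \<phi> x'" for x x' y
  proof -
    \<comment> \<open>two lifts of the same element differ by an element of the kernel, which is central\<close>
    let ?d = "x \<oplus>\<^bsub>E\<^esub> (\<ominus>\<^bsub>K\<^esub> \<one>\<^bsub>K\<^esub>) \<odot>\<^bsub>E\<^esub> x'"
    have "\<phi> ?d = \<zero>\<^bsub>L\<^esub>"
      using x by (simp add: \<phi> \<phi>_closed eq minus_one_smult M.r_neg)
    moreover have "?d \<in> carrier E" using x by auto
    ultimately have "?d \<in> lie_center E"
      using ext by (auto simp: central_extension_def)
    then have "?d \<otimes>\<^bsub>E\<^esub> y = \<zero>\<^bsub>E\<^esub>"
      using x by (auto simp: lie_center_def)
    then have "x \<otimes>\<^bsub>E\<^esub> y \<ominus>\<^bsub>E\<^esub> x' \<otimes>\<^bsub>E\<^esub> y = \<zero>\<^bsub>E\<^esub>"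
      using x by (simp add: E.bracket_add_left E.bracket_uminus_left E.minus_one_smult a_minus_def)
    then show ?thesis
      by (rule E.eq_if_diff_zero[rotated 2]) (use x in auto)
  qed
  have lift: "x \<otimes>\<^bsub>E\<^esub> y = x' \<otimes>\<^bsub>E\<^esub> y'"
    if "x \<in> carrier E" "x' \<in> carrier E" "y \<in> carrier E" "y' \<in> carrier E" "\<phi> x = \<phi> x'" "\<phi> y = \<phi> y'"
    for x x' y y'
  proof -
    have "x \<otimes>\<^bsub>E\<^esub> y = x' \<otimes>\<^bsub>E\<^esub> y"
      using that by (intro left)
    also have "\<dots> = \<ominus>\<^bsub>E\<^esub> (y \<otimes>\<^bsub>E\<^esub> x')"
      using that by (intro E.bracket_antisym)
    also have "y \<otimes>\<^bsub>E\<^esub> x' = y' \<otimes>\<^bsub>E\<^esub> x'"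
      using that by (intro left)
    also have "\<ominus>\<^bsub>E\<^esub> (y' \<otimes>\<^bsub>E\<^esub> x') = x' \<otimes>\<^bsub>E\<^esub> y'"
      using that by (intro E.bracket_antisym[symmetric])
    finally show ?thesis .
  qed
  define f where "f = (\<lambda>(l, m). s l \<otimes>\<^bsub>E\<^esub> s m)"
  have f: "f (\<phi> x, \<phi> y) = x \<otimes>\<^bsub>E\<^esub> y" if "x \<in> carrier E" "y \<in> carrier E" for x y
  proof -
    have "s (\<phi> x) \<otimes>\<^bsub>E\<^esub> s (\<phi> y) = x \<otimes>\<^bsub>E\<^esub> y"
      using that by (intro lift s \<phi>_closed)
    then show ?thesis by (simp add: f_def)
  qed
  have "\<exists>\<psi> \<in> lie_hom K (exterior_square K L) E.
      \<forall>p \<in> carrier L \<times> carrier L.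
        \<psi> (lie_class K (carrier L \<times> carrier L) (wedge_relations K L) (TGen p)) = f p"
    unfolding exterior_square_def
  proof (rule lie_presentation_universal[OF E.lie_algebra_axioms])
    show "f \<in> carrier L \<times> carrier L \<rightarrow> carrier E"
      using s by (auto simp: f_def)
  next
    fix t u assume "(t, u) \<in> wedge_relations K L"
    then show "lie_eval E f t = lie_eval E f u"
    proof cases
      case (wedge_add_left l l' m)
      then show ?thesis
        using f[of "s l \<oplus>\<^bsub>E\<^esub> s l'" "s m"] by (simp add: f_def s \<phi> E.bracket_add_left)
    next
      case (wedge_add_right l m m')
      then show ?thesis
        using f[of "s l" "s m \<oplus>\<^bsub>E\<^esub> s m'"] by (simp add: f_def s \<phi> E.bracket_add_right)
    next
      case (wedge_smult_left a l m)
      then show ?thesis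
        using f[of "a \<odot>\<^bsub>E\<^esub> s l" "s m"] by (simp add: f_def s \<phi> E.bracket_smult_left)
    next
      case (wedge_smult_right a l m)
      then show ?thesis
        using f[of "s l" "a \<odot>\<^bsub>E\<^esub> s m"] by (simp add: f_def s \<phi> E.bracket_smult_right)
    next
      case (wedge_self l)
      then show ?thesis
        by (simp add: f_def s E.bracket_self)
    next
      case (wedge_bracket_left l l' m)
      then show ?thesis
        using f[of "s l \<otimes>\<^bsub>E\<^esub> s l'" "s m"] f[of "s l" "s l' \<otimes>\<^bsub>E\<^esub> s m"]
          f[of "s l'" "s l \<otimes>\<^bsub>E\<^esub> s m"] E.bracket_bracket_left[of "s l" "s l'" "s m"]
        by (simp add: s \<phi> E.minus_one_smult a_minus_def)
    next
      case (wedge_bracket_right l m m')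
      then show ?thesis
        using f[of "s l" "s m \<otimes>\<^bsub>E\<^esub> s m'"] f[of "s m' \<otimes>\<^bsub>E\<^esub> s l" "s m"]
          f[of "s m \<otimes>\<^bsub>E\<^esub> s l" "s m'"] E.bracket_bracket_right[of "s l" "s m" "s m'"]
        by (simp add: s \<phi> E.minus_one_smult a_minus_def)
    next
      case (bracket_wedge l m l' m')
      then show ?thesis
        using f[of "s l \<otimes>\<^bsub>E\<^esub> s m" "s l' \<otimes>\<^bsub>E\<^esub> s m'"] by (simp add: f_def s \<phi>)
    qed
  qed
  then obtain \<psi> where \<psi>: "\<psi> \<in> lie_hom K (exterior_square K L) E"
    "\<And>p. p \<in> carrier L \<times> carrier L \<Longrightarrow>
      \<psi> (lie_class K (carrier L \<times> carrier L) (wedge_relations K L) (TGen p)) = f p"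
    by blast
  show ?thesis
    by (intro bexI[of _ \<psi>] ballI) (simp_all add: wedge_def \<psi> \<phi>_closed f)
qed

end


section \<open>The two centers\<close>

theorem lemma3p1:
  fixes K :: "('k, 'c) ring_scheme" and L :: "('k, 'v, 'm) module_scheme"
  assumes "fin_dim_lie_algebra K L"
  shows "Z_star K L = Z_wedge K L"
proof
  interpret fin_dim_lie_algebra K L by fact
  let ?W = "exterior_square K L"
  interpret W: lie_algebra K ?W by (rule lie_algebra_exterior_square)
  interpret lie_cocycle K L ?W "wedge K L" by (rule lie_cocycle_wedge)
  let ?E = "cocycle_extension L ?W (wedge K L)"
  have "Z_star K L \<subseteq> fst ` lie_center ?E"
    by (intro Z_star_subset central_extension_cocycle_extension finite_dim_exterior_square fin_dim)
  also have "\<dots> \<subseteq> Z_wedge K L"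
  proof
    fix x assume "x \<in> fst ` lie_center ?E"
    then obtain v where v: "(x, v) \<in> lie_center ?E" by auto
    have "wedge K L x y = \<zero>\<^bsub>?W\<^esub>" if "y \<in> carrier L" for y
    proof -
      have "(x, v) \<otimes>\<^bsub>?E\<^esub> (y, \<zero>\<^bsub>?W\<^esub>) = \<zero>\<^bsub>?E\<^esub>"
        using v that by (auto simp: lie_center_def cocycle_extension_simps)
      then show ?thesis by (simp add: cocycle_extension_simps)
    qed
    moreover have "x \<in> carrier L"
      using v by (auto simp: lie_center_def cocycle_extension_simps)
    ultimately show "x \<in> Z_wedge K L" by (simp add: Z_wedge_def)
  qed
  finally show "Z_star K L \<subseteq> Z_wedge K L" .
  have "l \<in> \<phi> ` lie_center E"
    if l: "l \<in> Z_wedge K L" and ext: "central_extension K L E \<phi>"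
    for l \<phi> and E :: "('k, nat \<Rightarrow> 'k) module"
  proof -
    interpret E: fin_dim_lie_algebra K E
      using ext by (simp add: central_extension_def)
    obtain \<psi> where \<psi>: "\<psi> \<in> lie_hom K ?W E"
      and \<psi>_wedge: "\<And>x y. \<lbrakk>x \<in> carrier E; y \<in> carrier E\<rbrakk> \<Longrightarrow> \<psi> (wedge K L (\<phi> x) (\<phi> y)) = x \<otimes>\<^bsub>E\<^esub> y"
      using exterior_square_to_central_extension[OF ext] by blast
    have "\<psi> (\<zero>\<^bsub>K\<^esub> \<odot>\<^bsub>?W\<^esub> \<zero>\<^bsub>?W\<^esub>) = \<zero>\<^bsub>K\<^esub> \<odot>\<^bsub>E\<^esub> \<psi> \<zero>\<^bsub>?W\<^esub>"
      using \<psi> W.M.zero_closed K.zero_closed unfolding lie_hom_def by blast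
    moreover have "\<psi> \<zero>\<^bsub>?W\<^esub> \<in> carrier E"
      using \<psi> by (auto simp: lie_hom_def)
    ultimately have \<psi>_zero: "\<psi> \<zero>\<^bsub>?W\<^esub> = \<zero>\<^bsub>E\<^esub>"
      by simp
    have "l \<in> \<phi> ` carrier E"
      using l ext by (simp add: Z_wedge_def central_extension_def)
    then obtain e where e: "e \<in> carrier E" "l = \<phi> e" by blast
    have "e \<otimes>\<^bsub>E\<^esub> y = \<zero>\<^bsub>E\<^esub>" if y: "y \<in> carrier E" for y
    proof -
      have "\<phi> y \<in> carrier L"
        using ext y by (auto simp: central_extension_def lie_hom_def)
      then have "wedge K L (\<phi> e) (\<phi> y) = \<zero>\<^bsub>?W\<^esub>"
        using l e(2) by (simp add: Z_wedge_def)
      then show ?thesis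
        using \<psi>_wedge[OF e(1) y] \<psi>_zero by simp
    qed
    then show ?thesis
      using e by (auto simp: lie_center_def)
  qed
  then show "Z_wedge K L \<subseteq> Z_star K L"
    unfolding Z_star_def by blast
qed

end
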